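(* Let $(\Omega,M)$ be a finite transitive transformation monoid. Then $(\Omega,M)$ is primitive if and only if, for every non-trivial orbital $\mathcal O$ of $M$, the orbital digraph $\Gamma(\mathcal O)$ is weakly connected.
   Context: A transformation monoid is a pair $(\Omega,M)$ where $\Omega$ is a non-empty set and $M$ is a submonoid of the monoid $T_\Omega$ of all self-maps of $\Omega$, acting on the right; it is finite if $\Omega$ is finite. It is transitive if $\alpha M=\Omega$ for all $\alpha\in\Omega$. A congruence on $\Omega$ is an equivalence relation $\equiv$ such that $\alpha\equiv\beta$ implies $\alpha m\equiv\beta m$ for all $m\in M$. It is non-trivial if it is not the equality relation, and proper if it is not the universal relation. $(\Omega,M)$ is primitive if it admits no non-trivial proper congruence. $M$ acts on $\Omega^2=\Omega\times\Omega$ by $(\alpha,\beta)m=(\alpha m,\beta m)$. The strong orbits of $M$ on a right $M$-set are the classes of the equivalence relation $x\sim y\iff xM=yM$; they are partially ordered by letting the strong orbit of $x$ be below that of $y$ iff $xM\subseteq yM$. For transitive $(\Omega,M)$ the diagonal $\Delta=\{(\alpha,\alpha)\mid\alpha\in\Omega\}$ is a strong orbit of $M$ on $\Omega^2$. A non-trivial orbital of $M$ is a strong orbit $\mathcal O\neq\Delta$ of $M$ on $\Omega^2$ that is minimal in the poset of all strong orbits of $M$ on $\Omega^2$ other than $\Delta$. The orbital digraph $\Gamma(\mathcal O)$ has vertex set $\Omega$ and edge set $\mathcal O$. A digraph is weakly connected if the equivalence relation on its vertices generated by its edges has a single class. *)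

theory Defs
  imports
    "Graph_Theory.Digraph_Component"
    "HOL-Algebra.Group"
begin

text \<open>
  Self-maps of \<open>\<Omega>\<close> are extensional functions, so that distinct elements of the carrier are
  distinct self-maps. Maps act on the right, so a product applies its left factor first:
  \<open>\<alpha> (f g) = (\<alpha> f) g\<close>. Where the mathematics writes \<open>\<alpha> m\<close>, we write \<open>m \<alpha>\<close>.
\<close>

definition full_transformation_monoid :: "'a set \<Rightarrow> ('a \<Rightarrow> 'a) monoid" where
  "full_transformation_monoid \<Omega> =
    \<lparr>carrier = \<Omega> \<rightarrow>\<^sub>E \<Omega>, monoid.mult = (\<lambda>f g. compose \<Omega> g f), one = (\<lambda>\<alpha>\<in>\<Omega>. \<alpha>)\<rparr>"

lemma monoid_full_transformation_monoid: "monoid (full_transformation_monoid \<Omega>)"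
  by (rule monoidI)
    (auto simp: full_transformation_monoid_def compose_def PiE_iff restrict_def extensional_def
      fun_eq_iff)

definition transformation_monoid :: "'a set \<Rightarrow> ('a \<Rightarrow> 'a) set \<Rightarrow> bool" where
  "transformation_monoid \<Omega> M \<longleftrightarrow> \<Omega> \<noteq> {} \<and> submonoid M (full_transformation_monoid \<Omega>)"

definition transitive :: "'a set \<Rightarrow> ('a \<Rightarrow> 'a) set \<Rightarrow> bool" where
  "transitive \<Omega> M \<longleftrightarrow> (\<forall>\<alpha>\<in>\<Omega>. {m \<alpha> | m. m \<in> M} = \<Omega>)"

definition congruence :: "'a set \<Rightarrow> ('a \<Rightarrow> 'a) set \<Rightarrow> 'a rel \<Rightarrow> bool" where
  "congruence \<Omega> M E \<longleftrightarrow>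
    equiv \<Omega> E \<and> (\<forall>\<alpha> \<beta>. (\<alpha>, \<beta>) \<in> E \<longrightarrow> (\<forall>m\<in>M. (m \<alpha>, m \<beta>) \<in> E))"

definition primitive :: "'a set \<Rightarrow> ('a \<Rightarrow> 'a) set \<Rightarrow> bool" where
  "primitive \<Omega> M \<longleftrightarrow> \<not> (\<exists>E. congruence \<Omega> M E \<and> E \<noteq> Id_on \<Omega> \<and> E \<noteq> \<Omega> \<times> \<Omega>)"

text \<open>
  Strong orbits are defined for an arbitrary right \<open>M\<close>-set \<open>X\<close>, whose action is given as a
  function \<open>act\<close>.
\<close>

definition cyclic_subact :: "('x \<Rightarrow> 'm \<Rightarrow> 'x) \<Rightarrow> 'm set \<Rightarrow> 'x \<Rightarrow> 'x set" where
  "cyclic_subact act M x = {act x m | m. m \<in> M}"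

definition strong_orbits :: "('x \<Rightarrow> 'm \<Rightarrow> 'x) \<Rightarrow> 'm set \<Rightarrow> 'x set \<Rightarrow> 'x set set" where
  "strong_orbits act M X =
    X // {(x, y). x \<in> X \<and> y \<in> X \<and> cyclic_subact act M x = cyclic_subact act M y}"

text \<open>
  By the definition of strong orbits, the choice of representatives below is immaterial.
\<close>

definition strong_orbit_le :: "('x \<Rightarrow> 'm \<Rightarrow> 'x) \<Rightarrow> 'm set \<Rightarrow> 'x set \<Rightarrow> 'x set \<Rightarrow> bool" where
  "strong_orbit_le act M A B \<longleftrightarrow>
    (\<exists>x\<in>A. \<exists>y\<in>B. cyclic_subact act M x \<subseteq> cyclic_subact act M y)"

definition pair_act :: "'a \<times> 'a \<Rightarrow> ('a \<Rightarrow> 'a) \<Rightarrow> 'a \<times> 'a" where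
  "pair_act p m = (m (fst p), m (snd p))"

definition nontrivial_orbital :: "'a set \<Rightarrow> ('a \<Rightarrow> 'a) set \<Rightarrow> 'a rel \<Rightarrow> bool" where
  "nontrivial_orbital \<Omega> M \<O> \<longleftrightarrow>
    \<O> \<in> strong_orbits pair_act M (\<Omega> \<times> \<Omega>) - {Id_on \<Omega>} \<and>
    (\<forall>\<O>' \<in> strong_orbits pair_act M (\<Omega> \<times> \<Omega>) - {Id_on \<Omega>}.
      strong_orbit_le pair_act M \<O>' \<O> \<longrightarrow> \<O>' = \<O>)"

definition orbital_digraph :: "'a set \<Rightarrow> 'a rel \<Rightarrow> 'a pair_pre_digraph" where
  "orbital_digraph \<Omega> \<O> = \<lparr>pverts = \<Omega>, parcs = \<O>\<rparr>"

definition generated_equiv :: "'a set \<Rightarrow> 'a rel \<Rightarrow> 'a rel" where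
  "generated_equiv V R = \<Inter> {E. equiv V E \<and> R \<subseteq> E}"

definition weakly_connected :: "('a, 'b) pre_digraph \<Rightarrow> bool" where
  "weakly_connected G \<longleftrightarrow> is_singleton (verts G // generated_equiv (verts G) (arcs_ends G))"

text \<open>
  On well-formed digraphs this agrees with the library's \<^const>\<open>connected\<close>, which is
  phrased via walks in the symmetrized digraph.
\<close>

lemma equiv_generated_equiv:
  assumes "R \<subseteq> V \<times> V"
  shows "equiv V (generated_equiv V R)"
proof -
  have "equiv V (V \<times> V)"
    by (auto simp: equiv_def refl_on_def sym_def trans_def)
  then have top: "V \<times> V \<in> {E. equiv V E \<and> R \<subseteq> E}"
    using assms by simp
  show ?thesis
  proof (rule equivI)
    show "generated_equiv V R \<subseteq> V \<times> V"
      unfolding generated_equiv_def using top by (rule Inter_lower)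
    show "refl_on V (generated_equiv V R)"
      unfolding generated_equiv_def refl_on_def equiv_def by blast
    show "sym (generated_equiv V R)"
      unfolding generated_equiv_def equiv_def sym_def by blast
    show "trans (generated_equiv V R)"
      unfolding generated_equiv_def equiv_def trans_def by blast
  qed
qed

lemma is_singleton_quotient_iff:
  assumes "equiv V E"
  shows "is_singleton (V // E) \<longleftrightarrow> V \<noteq> {} \<and> E = V \<times> V"
proof
  assume "is_singleton (V // E)"
  then obtain C where C: "V // E = {C}" by (auto simp: is_singleton_def)
  then have "V \<noteq> {}" by auto
  moreover have "(x, y) \<in> E" if "x \<in> V" "y \<in> V" for x y
  proof -
    have "E `` {x} = E `` {y}" using C that by (metis quotientI singletonD)
    then show ?thesis using assms that by (simp add: eq_equiv_class_iff)
  qed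
  ultimately show "V \<noteq> {} \<and> E = V \<times> V" using assms by (auto simp: equiv_def)
next
  assume *: "V \<noteq> {} \<and> E = V \<times> V"
  then have "V // E = {V}" by (auto simp: quotient_def)
  then show "is_singleton (V // E)" by (simp add: is_singleton_def)
qed

lemma (in wf_digraph) weakly_connected_iff_connected:
  "weakly_connected G \<longleftrightarrow> connected G"
proof -
  let ?V = "verts G" and ?R = "arcs_ends G"
  let ?W = "rtrancl_on ?V (?R\<^sup>s)"
  have sub: "?R \<subseteq> ?V \<times> ?V"
    by (auto simp: arcs_ends_conv)
  have "equiv ?V ?W"
  proof (rule equivI)
    show "?W \<subseteq> ?V \<times> ?V" by (auto dest: in_rtrancl_on_in_F)
    show "refl_on ?V ?W" by (auto simp: refl_on_def)
    show "sym ?W" by (rule rtrancl_on_sym) (auto simp: symcl_def sym_def)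
    show "trans ?W" by (auto intro: transI rtrancl_on_trans)
  qed
  moreover have "?R \<subseteq> ?W"
  proof
    fix p assume p: "p \<in> ?R"
    then obtain a b where "p = (a, b)" "a \<in> ?V" "b \<in> ?V" using sub by auto
    with p show "p \<in> ?W"
      by (auto simp: symcl_def intro: rtrancl_on_into_rtrancl_on)
  qed
  ultimately have "generated_equiv ?V ?R \<subseteq> ?W"
    by (auto simp: generated_equiv_def)
  moreover have "?W \<subseteq> E" if E: "equiv ?V E" "?R \<subseteq> E" for E
  proof
    fix p assume "p \<in> ?W"
    then obtain a b where p: "p = (a, b)" "(a, b) \<in> ?W" by (cases p) auto
    from p(2) have "(a, b) \<in> E"
    proof (induction rule: rtrancl_on_induct)
      case base
      then show ?case using E by (auto simp: equiv_def refl_on_def)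
    next
      case (step y z)
      have "(y, z) \<in> E"
        using step E by (auto simp: symcl_def equiv_def dest: symD)
      with step show ?case using E by (meson equiv_def transD)
    qed
    with p show "p \<in> E" by simp
  qed
  ultimately have "generated_equiv ?V ?R = ?W"
    unfolding generated_equiv_def by blast
  moreover have "?W = ?V \<times> ?V \<longleftrightarrow> (\<forall>u\<in>?V. \<forall>v\<in>?V. (u, v) \<in> ?W)"
    using \<open>equiv ?V ?W\<close> by (auto simp: equiv_def)
  ultimately show ?thesis
    unfolding weakly_connected_def is_singleton_quotient_iff[OF equiv_generated_equiv[OF sub]]
      connected_conv by simp
qed

end

theory Submission
  imports Defs
begin

text \<open>
  A minimal strong orbit \<open>\<O>\<close> off the diagonal has nowhere to go but into itself and the diagonal:
  an element of \<open>M\<close> either keeps a pair in \<open>\<O>\<close> or collapses it. This is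
  \<open>nontrivial_orbital_image\<close>, and it makes the equivalence generated by \<open>\<O>\<close> a congruence
  (\<open>congruence_generated_equiv\<close>). That congruence is not equality, since \<open>\<O>\<close> is non-empty and disjoint
  from the diagonal; primitivity therefore makes it universal, which is weak connectedness of \<open>\<Gamma>(\<O>)\<close>.

  Conversely, the pairs of a congruence \<open>E\<close> form an \<open>M\<close>-invariant set, hence a down-set of strong
  orbits. If \<open>E\<close> is not equality, finiteness yields a non-trivial orbital inside \<open>E\<close>
  (\<open>congruence_contains_orbital\<close>). If its digraph is weakly connected, \<open>E\<close> contains the universal
  relation that it generates, so \<open>E\<close> is not proper.

  Transitivity enters only through the diagonal: it makes \<open>\<Delta>\<close> a strong orbit, so that every
  other strong orbit on pairs avoids \<open>\<Delta>\<close> altogether (\<open>strong_orbit_off_diagonal\<close>).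
\<close>

lemma strong_orbits_iff:
  "C \<in> strong_orbits act M X \<longleftrightarrow>
    (\<exists>x\<in>X. C = {y \<in> X. cyclic_subact act M y = cyclic_subact act M x})"
  unfolding strong_orbits_def quotient_def by auto

lemma transformation_monoid_closed:
  assumes "transformation_monoid \<Omega> M" "m \<in> M" "\<alpha> \<in> \<Omega>"
  shows "m \<alpha> \<in> \<Omega>"
  using assms submonoid.subset[of M "full_transformation_monoid \<Omega>"]
  by (auto simp: transformation_monoid_def full_transformation_monoid_def)

lemma transformation_monoid_one:
  assumes "transformation_monoid \<Omega> M"
  shows "(\<lambda>\<alpha>\<in>\<Omega>. \<alpha>) \<in> M"
  using assms submonoid.one_closed[of M "full_transformation_monoid \<Omega>"]
  by (simp add: transformation_monoid_def full_transformation_monoid_def)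

lemma transformation_monoid_compose:
  assumes "transformation_monoid \<Omega> M" "m \<in> M" "n \<in> M"
  shows "compose \<Omega> n m \<in> M"
  using assms submonoid.m_closed[of M "full_transformation_monoid \<Omega>" m n]
  by (simp add: transformation_monoid_def full_transformation_monoid_def)

lemma pair_in_cyclic_subact:
  assumes "transformation_monoid \<Omega> M" "p \<in> \<Omega> \<times> \<Omega>"
  shows "p \<in> cyclic_subact pair_act M p"
proof -
  have "p = pair_act p (\<lambda>\<alpha>\<in>\<Omega>. \<alpha>)"
    using assms(2) by (auto simp: pair_act_def)
  then show ?thesis
    using transformation_monoid_one[OF assms(1)] unfolding cyclic_subact_def by blast
qed

lemma cyclic_subact_pair_subset:
  assumes tm: "transformation_monoid \<Omega> M" and p: "p \<in> \<Omega> \<times> \<Omega>"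
    and q: "q \<in> cyclic_subact pair_act M p"
  shows "cyclic_subact pair_act M q \<subseteq> cyclic_subact pair_act M p"
proof
  fix r assume "r \<in> cyclic_subact pair_act M q"
  then obtain n where n: "n \<in> M" "r = pair_act q n" by (auto simp: cyclic_subact_def)
  from q obtain m where m: "m \<in> M" "q = pair_act p m" by (auto simp: cyclic_subact_def)
  have "r = pair_act p (compose \<Omega> n m)"
    using p n m by (auto simp: pair_act_def compose_def)
  then show "r \<in> cyclic_subact pair_act M p"
    using transformation_monoid_compose[OF tm m(1) n(1)] unfolding cyclic_subact_def by blast
qed

lemma cyclic_subact_diagonal:
  assumes "transitive \<Omega> M" "\<alpha> \<in> \<Omega>"
  shows "cyclic_subact pair_act M (\<alpha>, \<alpha>) = Id_on \<Omega>"
proof -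
  have "cyclic_subact pair_act M (\<alpha>, \<alpha>) = (\<lambda>\<beta>. (\<beta>, \<beta>)) ` {m \<alpha> | m. m \<in> M}"
    by (auto simp: cyclic_subact_def pair_act_def)
  also have "\<dots> = (\<lambda>\<beta>. (\<beta>, \<beta>)) ` \<Omega>"
    using assms unfolding transitive_def by simp
  finally show ?thesis by auto
qed

lemma strong_orbit_off_diagonal:
  assumes tm: "transformation_monoid \<Omega> M" and tr: "transitive \<Omega> M"
    and C: "C \<in> strong_orbits pair_act M (\<Omega> \<times> \<Omega>)" "C \<noteq> Id_on \<Omega>"
  shows "C \<inter> Id_on \<Omega> = {}"
proof (rule ccontr)
  let ?cyc = "cyclic_subact pair_act M"
  assume "C \<inter> Id_on \<Omega> \<noteq> {}"
  then obtain \<alpha> where \<alpha>: "\<alpha> \<in> \<Omega>" "(\<alpha>, \<alpha>) \<in> C" by auto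
  with C(1) have "C = {q \<in> \<Omega> \<times> \<Omega>. ?cyc q = ?cyc (\<alpha>, \<alpha>)}"
    unfolding strong_orbits_iff by auto
  then have C_eq: "C = {q \<in> \<Omega> \<times> \<Omega>. ?cyc q = Id_on \<Omega>}"
    using cyclic_subact_diagonal[OF tr \<alpha>(1)] by simp
  have "C \<subseteq> Id_on \<Omega>"
    using pair_in_cyclic_subact[OF tm] unfolding C_eq by blast
  moreover have "Id_on \<Omega> \<subseteq> C"
    using cyclic_subact_diagonal[OF tr] unfolding C_eq by auto
  ultimately show False using C(2) by blast
qed

lemma nontrivial_orbital_subset:
  assumes "nontrivial_orbital \<Omega> M \<O>"
  shows "\<O> \<subseteq> \<Omega> \<times> \<Omega>"
  using assms by (auto simp: nontrivial_orbital_def strong_orbits_iff)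

text \<open>
  The image of a pair of \<open>\<O>\<close> lies in a strong orbit below \<open>\<O>\<close>; by minimality such a strong
  orbit is \<open>\<O>\<close> or the diagonal.
\<close>

lemma nontrivial_orbital_image:
  assumes tm: "transformation_monoid \<Omega> M" and orb: "nontrivial_orbital \<Omega> M \<O>"
    and ab: "(\<alpha>, \<beta>) \<in> \<O>" and m: "m \<in> M"
  shows "(m \<alpha>, m \<beta>) \<in> \<O> \<union> Id_on \<Omega>"
proof -
  let ?cyc = "cyclic_subact pair_act M"
  let ?q = "(m \<alpha>, m \<beta>)"
  define C where "C = {r \<in> \<Omega> \<times> \<Omega>. ?cyc r = ?cyc ?q}"
  have ab_in: "(\<alpha>, \<beta>) \<in> \<Omega> \<times> \<Omega>" using nontrivial_orbital_subset[OF orb] ab by blast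
  have q_in: "?q \<in> \<Omega> \<times> \<Omega>" using transformation_monoid_closed[OF tm m] ab_in by simp
  then have C: "C \<in> strong_orbits pair_act M (\<Omega> \<times> \<Omega>)"
    unfolding strong_orbits_iff C_def by blast
  have q_C: "?q \<in> C" using q_in by (simp add: C_def)
  have "?q \<in> ?cyc (\<alpha>, \<beta>)"
    using m by (auto simp: cyclic_subact_def pair_act_def)
  then have "?cyc ?q \<subseteq> ?cyc (\<alpha>, \<beta>)" by (rule cyclic_subact_pair_subset[OF tm ab_in])
  then have "strong_orbit_le pair_act M C \<O>"
    unfolding strong_orbit_le_def using q_C ab by blast
  then have "C = \<O> \<or> C = Id_on \<Omega>"
    using orb C unfolding nontrivial_orbital_def by blast
  then show ?thesis using q_C by blast
qed

lemma generated_equiv_superset: "R \<subseteq> generated_equiv V R"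
  unfolding generated_equiv_def by blast

lemma generated_equiv_least: "equiv V E \<Longrightarrow> R \<subseteq> E \<Longrightarrow> generated_equiv V R \<subseteq> E"
  unfolding generated_equiv_def by blast

text \<open>
  The pairs that every element of \<open>M\<close> sends into the generated equivalence form an equivalence
  relation containing the generators, so they include the whole generated equivalence.
\<close>

lemma congruence_generated_equiv:
  assumes closed: "\<And>m \<alpha>. m \<in> M \<Longrightarrow> \<alpha> \<in> \<Omega> \<Longrightarrow> m \<alpha> \<in> \<Omega>"
    and R: "R \<subseteq> \<Omega> \<times> \<Omega>"
    and image: "\<And>\<alpha> \<beta> m. (\<alpha>, \<beta>) \<in> R \<Longrightarrow> m \<in> M \<Longrightarrow> (m \<alpha>, m \<beta>) \<in> generated_equiv \<Omega> R"
  shows "congruence \<Omega> M (generated_equiv \<Omega> R)"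
proof -
  let ?G = "generated_equiv \<Omega> R"
  define H where "H = {(\<alpha>, \<beta>) \<in> \<Omega> \<times> \<Omega>. \<forall>m\<in>M. (m \<alpha>, m \<beta>) \<in> ?G}"
  have G: "equiv \<Omega> ?G" using R by (rule equiv_generated_equiv)
  then have G_refl: "refl_on \<Omega> ?G" and G_sym: "sym ?G" and G_trans: "trans ?G"
    by (auto simp: equiv_def)
  have "equiv \<Omega> H"
  proof (rule equivI)
    show "H \<subseteq> \<Omega> \<times> \<Omega>" by (auto simp: H_def)
    show "refl_on \<Omega> H" using closed G_refl by (auto simp: H_def refl_on_def)
    show "sym H" using G_sym by (auto simp: H_def sym_def)
    show "trans H" using G_trans unfolding H_def trans_def by blast
  qed
  moreover have "R \<subseteq> H" using R image by (auto simp: H_def)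
  ultimately have "?G \<subseteq> H" by (rule generated_equiv_least)
  then show ?thesis using G by (auto simp: congruence_def H_def)
qed

lemma cyclic_subact_congruence:
  assumes "congruence \<Omega> M E" "p \<in> E"
  shows "cyclic_subact pair_act M p \<subseteq> E"
  using assms by (cases p) (auto simp: congruence_def cyclic_subact_def pair_act_def)

text \<open>
  The orbital is the strong orbit of an off-diagonal pair \<open>p\<close> of \<open>E\<close> whose cyclic subact \<open>pM\<close> has
  least cardinality. Any strong orbit below it, if not the diagonal, consists of competitors of \<open>p\<close>
  in this choice, and for finite sets an inclusion between cyclic subacts of equal size is an equality.
\<close>

lemma congruence_contains_orbital:
  assumes tm: "transformation_monoid \<Omega> M" and fin: "finite \<Omega>" and tr: "transitive \<Omega> M"
    and E: "congruence \<Omega> M E" "E \<noteq> Id_on \<Omega>"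
  obtains \<O> where "nontrivial_orbital \<Omega> M \<O>" "\<O> \<subseteq> E"
proof -
  let ?cyc = "cyclic_subact pair_act M"
  have E_sub: "E \<subseteq> \<Omega> \<times> \<Omega>" and "Id_on \<Omega> \<subseteq> E"
    using E(1) by (auto simp: congruence_def equiv_def refl_on_def)
  with E(2) have "\<exists>p. p \<in> E - Id_on \<Omega>" by blast
  then obtain p where p: "p \<in> E - Id_on \<Omega>"
    and p_min: "\<And>q. q \<in> E - Id_on \<Omega> \<Longrightarrow> card (?cyc p) \<le> card (?cyc q)"
    using ex_has_least_nat[of "\<lambda>p. p \<in> E - Id_on \<Omega>" _ "\<lambda>p. card (?cyc p)"]
    by metis
  have p_in: "p \<in> \<Omega> \<times> \<Omega>" using p E_sub by blast
  have cyc_p: "?cyc p \<subseteq> E" using E(1) p by (intro cyclic_subact_congruence) auto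
  then have fin_p: "finite (?cyc p)"
    using E_sub fin by (meson finite_SigmaI finite_subset)
  define \<O> where "\<O> = {q \<in> \<Omega> \<times> \<Omega>. ?cyc q = ?cyc p}"
  have "\<O> \<in> strong_orbits pair_act M (\<Omega> \<times> \<Omega>)"
    using p_in unfolding strong_orbits_iff \<O>_def by blast
  moreover have "\<O> \<noteq> Id_on \<Omega>" using p p_in by (auto simp: \<O>_def)
  moreover have "C = \<O>"
    if C: "C \<in> strong_orbits pair_act M (\<Omega> \<times> \<Omega>)" "C \<noteq> Id_on \<Omega>"
      and le: "strong_orbit_le pair_act M C \<O>" for C
  proof -
    from le obtain q where q: "q \<in> C" "?cyc q \<subseteq> ?cyc p"
      by (auto simp: strong_orbit_le_def \<O>_def)
    have C_eq: "C = {r \<in> \<Omega> \<times> \<Omega>. ?cyc r = ?cyc q}"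
      using C(1) q(1) unfolding strong_orbits_iff by auto
    have "q \<in> \<Omega> \<times> \<Omega>" using q(1) C_eq by blast
    then have "q \<in> E" using pair_in_cyclic_subact[OF tm] q(2) cyc_p by blast
    moreover have "q \<notin> Id_on \<Omega>" using strong_orbit_off_diagonal[OF tm tr C] q(1) by blast
    ultimately have "card (?cyc p) \<le> card (?cyc q)" by (intro p_min) blast
    then have "?cyc q = ?cyc p" using card_seteq[OF fin_p q(2)] by blast
    then show ?thesis unfolding C_eq \<O>_def by simp
  qed
  ultimately have "nontrivial_orbital \<Omega> M \<O>"
    unfolding nontrivial_orbital_def by blast
  moreover have "\<O> \<subseteq> E"
    using pair_in_cyclic_subact[OF tm] cyc_p unfolding \<O>_def by blast
  ultimately show thesis by (rule that)
qed

lemma weakly_connected_orbital_digraph_iff: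
  assumes "\<O> \<subseteq> \<Omega> \<times> \<Omega>" "\<Omega> \<noteq> {}"
  shows "weakly_connected (with_proj (orbital_digraph \<Omega> \<O>)) \<longleftrightarrow> generated_equiv \<Omega> \<O> = \<Omega> \<times> \<Omega>"
proof -
  have "arcs_ends (with_proj (orbital_digraph \<Omega> \<O>)) = \<O>"
    by (auto simp: orbital_digraph_def arcs_ends_def arc_to_ends_def)
  then show ?thesis
    using is_singleton_quotient_iff[OF equiv_generated_equiv[OF assms(1)]] assms(2)
    by (simp add: weakly_connected_def orbital_digraph_def)
qed

theorem theorem6p7:
  fixes \<Omega> :: "'a set" and M :: "('a \<Rightarrow> 'a) set"
  assumes "transformation_monoid \<Omega> M" and "finite \<Omega>" and "transitive \<Omega> M"
  shows "primitive \<Omega> M \<longleftrightarrow>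
    (\<forall>\<O>. nontrivial_orbital \<Omega> M \<O> \<longrightarrow> weakly_connected (with_proj (orbital_digraph \<Omega> \<O>)))"
proof (intro iffI allI impI)
  fix \<O>
  assume prim: "primitive \<Omega> M" and orb: "nontrivial_orbital \<Omega> M \<O>"
  let ?G = "generated_equiv \<Omega> \<O>"
  have sub: "\<O> \<subseteq> \<Omega> \<times> \<Omega>" using orb by (rule nontrivial_orbital_subset)
  have "Id_on \<Omega> \<subseteq> ?G"
    using equiv_generated_equiv[OF sub] by (auto simp: equiv_def refl_on_def)
  then have "\<O> \<union> Id_on \<Omega> \<subseteq> ?G" using generated_equiv_superset by blast
  then have "congruence \<Omega> M ?G"
    using nontrivial_orbital_image[OF assms(1) orb] transformation_monoid_closed[OF assms(1)] sub
    by (intro congruence_generated_equiv) blast+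
  moreover have "?G \<noteq> Id_on \<Omega>"
  proof -
    have orbit: "\<O> \<in> strong_orbits pair_act M (\<Omega> \<times> \<Omega>)" "\<O> \<noteq> Id_on \<Omega>"
      using orb by (auto simp: nontrivial_orbital_def)
    from orbit(1) have "\<O> \<noteq> {}" by (auto simp: strong_orbits_iff)
    then show ?thesis
      using strong_orbit_off_diagonal[OF assms(1,3) orbit] generated_equiv_superset[of \<O> \<Omega>] by blast
  qed
  ultimately have "?G = \<Omega> \<times> \<Omega>" using prim unfolding primitive_def by blast
  then show "weakly_connected (with_proj (orbital_digraph \<Omega> \<O>))"
    using weakly_connected_orbital_digraph_iff[OF sub] assms(1)
    by (simp add: transformation_monoid_def)
next
  assume conn: "\<forall>\<O>. nontrivial_orbital \<Omega> M \<O> \<longrightarrow> weakly_connected (with_proj (orbital_digraph \<Omega> \<O>))"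
  have "E = \<Omega> \<times> \<Omega>" if E: "congruence \<Omega> M E" "E \<noteq> Id_on \<Omega>" for E
  proof -
    obtain \<O> where orb: "nontrivial_orbital \<Omega> M \<O>" and \<O>: "\<O> \<subseteq> E"
      using congruence_contains_orbital[OF assms E] .
    have E_equiv: "equiv \<Omega> E" using E(1) by (simp add: congruence_def)
    have "generated_equiv \<Omega> \<O> = \<Omega> \<times> \<Omega>"
      using conn orb weakly_connected_orbital_digraph_iff[OF nontrivial_orbital_subset[OF orb]]
        assms(1) by (simp add: transformation_monoid_def)
    then have "\<Omega> \<times> \<Omega> \<subseteq> E" using generated_equiv_least[OF E_equiv \<O>] by simp
    then show ?thesis using E_equiv by (auto simp: equiv_def)
  qed
  then show "primitive \<Omega> M" unfolding primitive_def by blast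
qed

end
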